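(* Let $X$ and $\Omega$ be sets. (a) The $\Omega$-operated monoids $\mathcal{M}(X,\Omega)$ and $\mathcal{W}(X,\Omega)$ are naturally isomorphic. (b) The $\Omega$-operated monoids $\mathcal{M}(X,\Omega)$ and $\mathcal{P}(X,\Omega)$ are naturally isomorphic. (c) The $\Omega$-operated semigroups $\mathcal{S}(X,\Omega)$ and $\mathcal{L}(X,\Omega)$ are naturally isomorphic. Here "naturally isomorphic" means isomorphic by an isomorphism of $\Omega$-operated monoids (resp. semigroups) that is compatible with the canonical maps from $X$, i.e. that matches, for each $x\in X$, the element $x$ of $\mathcal{M}(X,\Omega)$, $\mathcal{S}(X,\Omega)$, $\mathcal{W}(X,\Omega)$ and the path $\ell_x$ (a single level step decorated by $x$) of $\mathcal{P}(X,\Omega)$, $\mathcal{L}(X,\Omega)$.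
   Context: **Operated semigroups and monoids.** An $\Omega$-operated semigroup (resp. monoid) is a semigroup (resp. monoid) $U$ together with a family of maps of sets $\alpha_\omega:U\to U$, $\omega\in\Omega$ (no compatibility with the product is required). A morphism is a semigroup (resp. monoid) homomorphism commuting with the operators indexed by each $\omega$. **Bracketed words.** For a set $Y$, let $S(Y)$ be the free semigroup and $M(Y)$ the free monoid on $Y$, with identity $\mathbf{1}$. For $\omega\in\Omega$ let $\lfloor_\omega Y\rfloor_\omega=\{\lfloor_\omega y\rfloor_\omega\mid y\in Y\}$ be a set of formal symbols in bijection with $Y$ and disjoint from $Y$; these sets are pairwise disjoint as $\omega$ varies. Put $\mathcal{S}_0=S(X)$, $\mathcal{M}_0=M(X)$ and, for $n\ge1$, $\mathcal{S}_n=S\big(X\cup\bigcup_{\omega\in\Omega}\lfloor_\omega\mathcal{S}_{n-1}\rfloor_\omega\big)$, $\mathcal{M}_n=M\big(X\cup\bigcup_{\omega\in\Omega}\lfloor_\omega\mathcal{M}_{n-1}\rfloor_\omega\big)$, with the natural inclusions $\mathcal{S}_{n-1}\hookrightarrow\mathcal{S}_n$, $\mathcal{M}_{n-1}\hookrightarrow\mathcal{M}_n$ induced inductively by $X\hookrightarrow X\cup\bigcup_\omega\lfloor_\omega\cdot\rfloor_\omega$ and by the previous inclusions. Set $\mathcal{S}(X,\Omega)=\bigcup_{n}\mathcal{S}_n$ and $\mathcal{M}(X,\Omega)=\bigcup_n\mathcal{M}_n$ (direct limits), with concatenation product and operators $\mathfrak{m}\mapsto\lfloor_\omega\mathfrak{m}\rfloor_\omega$,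 $\omega\in\Omega$. **Motzkin words.** Let $M_{X,\Omega}$ be the free monoid on the disjoint union of letters $X\cup\{/_\omega\mid\omega\in\Omega\}\cup\{\backslash_\omega\mid\omega\in\Omega\}$, with operators $P_\omega(\mathfrak{m})=/_\omega\,\mathfrak{m}\,\backslash_\omega$. $\mathcal{W}(X,\Omega)$ is the $\Omega$-operated submonoid (submonoid closed under all $P_\omega$) of $M_{X,\Omega}$ generated by $X$. **Motzkin paths.** A Motzkin path is a lattice path in $\mathbb{N}^2$ (with $\mathbb{N}$ the non-negative integers) from $(0,0)$ to some $(n,0)$, $n\ge 0$, with steps $(1,1)$ (up), $(1,-1)$ (down) and $(1,0)$ (level). The trivial path is denoted $\bullet$. A matching pair of steps consists of an up step and a down step to its right such that the path strictly between them is a Motzkin path. An $(X,\Omega)$-decorated Motzkin path is a Motzkin path in which each matching pair of steps is decorated by an element of $\Omega$ (the same element on both steps) and each level step is decorated by an element of $X$. $\mathcal{P}(X,\Omega)$ is the monoid of these under the link product (joining paths end to end), with operators $\mathfrak{m}\mapsto/_\omega\,\mathfrak{m}\,\backslash_\omega$ adding an up step at the left end and a down step at the right end, both decorated by $\omega$. $\mathcal{L}(X,\Omega)$ is the $\Omega$-operated subsemigroup of peak-free paths: those not equal to $\bullet$ with no up step immediately followed by a down step. *)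

theory Defs
  imports "HOL.Hull" "HOL-Algebra.Group" "HOL-Library.Product_Plus"
begin

section \<open>Operated semigroups and monoids\<close>

record ('a, 'w) operated = "'a monoid" +
  oper :: "'w \<Rightarrow> 'a \<Rightarrow> 'a"

text \<open>Operated semigroups are carried by the same record type as operated monoids. Neither the
  axioms nor the morphisms of operated semigroups refer to the field \<^const>\<open>one\<close>.\<close>

locale operated_semigroup =
  fixes \<Omega> :: "'w set" and G :: "('a, 'w, 'm) operated_scheme" (structure)
  assumes m_closed: "\<lbrakk>x \<in> carrier G; y \<in> carrier G\<rbrakk> \<Longrightarrow> x \<otimes> y \<in> carrier G"
    and m_assoc: "\<lbrakk>x \<in> carrier G; y \<in> carrier G; z \<in> carrier G\<rbrakk> \<Longrightarrow> (x \<otimes> y) \<otimes> z = x \<otimes> (y \<otimes> z)"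
    and oper_closed: "\<lbrakk>\<omega> \<in> \<Omega>; x \<in> carrier G\<rbrakk> \<Longrightarrow> oper G \<omega> x \<in> carrier G"

locale operated_monoid = monoid G
  for \<Omega> :: "'w set" and G :: "('a, 'w, 'm) operated_scheme" (structure) +
  assumes oper_closed: "\<lbrakk>\<omega> \<in> \<Omega>; x \<in> carrier G\<rbrakk> \<Longrightarrow> oper G \<omega> x \<in> carrier G"

locale operated_semigroup_hom = G: operated_semigroup \<Omega> G + H: operated_semigroup \<Omega> H
  for \<Omega> :: "'w set" and G :: "('a, 'w, 'm) operated_scheme"
    and H :: "('b, 'w, 'n) operated_scheme" and h :: "'a \<Rightarrow> 'b" +
  assumes homh: "h \<in> hom G H"
    and oper_hom: "\<lbrakk>\<omega> \<in> \<Omega>; x \<in> carrier G\<rbrakk> \<Longrightarrow> h (oper G \<omega> x) = oper H \<omega> (h x)"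

locale operated_monoid_hom = G: operated_monoid \<Omega> G + H: operated_monoid \<Omega> H
  for \<Omega> :: "'w set" and G :: "('a, 'w, 'm) operated_scheme"
    and H :: "('b, 'w, 'n) operated_scheme" and h :: "'a \<Rightarrow> 'b" +
  assumes homh: "h \<in> hom G H"
    and one_hom: "h \<one>\<^bsub>G\<^esub> = \<one>\<^bsub>H\<^esub>"
    and oper_hom: "\<lbrakk>\<omega> \<in> \<Omega>; x \<in> carrier G\<rbrakk> \<Longrightarrow> h (oper G \<omega> x) = oper H \<omega> (h x)"

locale operated_semigroup_iso = operated_semigroup_hom +
  assumes bij: "bij_betw h (carrier G) (carrier H)"

locale operated_monoid_iso = operated_monoid_hom +
  assumes bij: "bij_betw h (carrier G) (carrier H)"

locale operated_submonoid = submonoid H G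
  for \<Omega> :: "'w set" and H :: "'a set" and G :: "('a, 'w, 'm) operated_scheme" (structure) +
  assumes oper_closed: "\<lbrakk>\<omega> \<in> \<Omega>; x \<in> H\<rbrakk> \<Longrightarrow> oper G \<omega> x \<in> H"


section \<open>Bracketed words\<close>

text \<open>The free monoid on \<open>Y\<close> is the set \<^term>\<open>lists Y\<close> under concatenation, and the free
  semigroup is \<^term>\<open>lists Y - {[]}\<close>. All stages of the construction live in one type of words,
  so that the inclusions between consecutive stages are inclusions of sets and the direct limit
  is a union.\<close>

datatype ('x, 'w) bletter = Gen 'x | Bracket 'w "('x, 'w) bletter list"

primrec M_stage :: "'x set \<Rightarrow> 'w set \<Rightarrow> nat \<Rightarrow> ('x, 'w) bletter list set" where
  "M_stage X \<Omega> 0 = lists (Gen ` X)"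
| "M_stage X \<Omega> (Suc n) = lists (Gen ` X \<union> (\<Union>\<omega>\<in>\<Omega>. Bracket \<omega> ` M_stage X \<Omega> n))"

primrec S_stage :: "'x set \<Rightarrow> 'w set \<Rightarrow> nat \<Rightarrow> ('x, 'w) bletter list set" where
  "S_stage X \<Omega> 0 = lists (Gen ` X) - {[]}"
| "S_stage X \<Omega> (Suc n) = lists (Gen ` X \<union> (\<Union>\<omega>\<in>\<Omega>. Bracket \<omega> ` S_stage X \<Omega> n)) - {[]}"

definition bracketed_monoid :: "'x set \<Rightarrow> 'w set \<Rightarrow> (('x, 'w) bletter list, 'w) operated" where
  "bracketed_monoid X \<Omega> =
     \<lparr>carrier = (\<Union>n. M_stage X \<Omega> n), mult = (@), one = [], oper = (\<lambda>\<omega> m. [Bracket \<omega> m])\<rparr>"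

definition bracketed_semigroup :: "'x set \<Rightarrow> 'w set \<Rightarrow> (('x, 'w) bletter list, 'w) operated" where
  "bracketed_semigroup X \<Omega> =
     \<lparr>carrier = (\<Union>n. S_stage X \<Omega> n), mult = (@), one = undefined,
      oper = (\<lambda>\<omega> m. [Bracket \<omega> m])\<rparr>"


section \<open>Motzkin words\<close>

datatype ('x, 'w) mletter = Letter 'x | Slash 'w | Backslash 'w

definition slash_monoid :: "'x set \<Rightarrow> 'w set \<Rightarrow> (('x, 'w) mletter list, 'w) operated" where
  "slash_monoid X \<Omega> =
     \<lparr>carrier = lists (Letter ` X \<union> Slash ` \<Omega> \<union> Backslash ` \<Omega>), mult = (@), one = [],
      oper = (\<lambda>\<omega> m. [Slash \<omega>] @ m @ [Backslash \<omega>])\<rparr>"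

definition motzkin_words :: "'x set \<Rightarrow> 'w set \<Rightarrow> (('x, 'w) mletter list, 'w) operated" where
  "motzkin_words X \<Omega> = (slash_monoid X \<Omega>)
     \<lparr>carrier := (\<lambda>H. operated_submonoid \<Omega> H (slash_monoid X \<Omega>)) hull ((\<lambda>x. [Letter x]) ` X)\<rparr>"


section \<open>Motzkin paths\<close>

text \<open>A lattice path starting at the origin is given by its list of steps.\<close>

datatype step = Up | Down | Level

primrec direction :: "step \<Rightarrow> int \<times> int" where
  "direction Up = (1, 1)"
| "direction Down = (1, -1)"
| "direction Level = (1, 0)"

definition vertex :: "step list \<Rightarrow> nat \<Rightarrow> int \<times> int" where
  "vertex p k = (\<Sum>s\<leftarrow>take k p. direction s)"

definition motzkin_path :: "step list \<Rightarrow> bool" where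
  "motzkin_path p \<longleftrightarrow>
     (\<forall>k\<le>length p. vertex p k \<in> {0..} \<times> {0..}) \<and> (\<exists>n\<ge>0. vertex p (length p) = (n, 0))"

text \<open>The path strictly between two steps is translated so as to start at the origin.\<close>

definition matching_pair :: "step list \<Rightarrow> nat \<Rightarrow> nat \<Rightarrow> bool" where
  "matching_pair p i j \<longleftrightarrow>
     i < j \<and> j < length p \<and> p ! i = Up \<and> p ! j = Down \<and>
     motzkin_path (take (j - Suc i) (drop (Suc i) p))"

datatype ('x, 'w) dstep = DUp 'w | DDown 'w | DLevel 'x

primrec undecorate :: "('x, 'w) dstep \<Rightarrow> step" where
  "undecorate (DUp \<omega>) = Up"
| "undecorate (DDown \<omega>) = Down"
| "undecorate (DLevel x) = Level"

text \<open>In a Motzkin path every up step and every down step belongs to exactly one matching pair,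
  so the conditions below constrain the decoration of every step.\<close>

definition decorated_motzkin_path :: "'x set \<Rightarrow> 'w set \<Rightarrow> ('x, 'w) dstep list \<Rightarrow> bool" where
  "decorated_motzkin_path X \<Omega> p \<longleftrightarrow>
     motzkin_path (map undecorate p) \<and>
     (\<forall>i j. matching_pair (map undecorate p) i j \<longrightarrow> (\<exists>\<omega>\<in>\<Omega>. p ! i = DUp \<omega> \<and> p ! j = DDown \<omega>)) \<and>
     (\<forall>i<length p. undecorate (p ! i) = Level \<longrightarrow> (\<exists>x\<in>X. p ! i = DLevel x))"

definition motzkin_paths :: "'x set \<Rightarrow> 'w set \<Rightarrow> (('x, 'w) dstep list, 'w) operated" where
  "motzkin_paths X \<Omega> =
     \<lparr>carrier = {p. decorated_motzkin_path X \<Omega> p}, mult = (@), one = [],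
      oper = (\<lambda>\<omega> m. [DUp \<omega>] @ m @ [DDown \<omega>])\<rparr>"

definition peak_free :: "step list \<Rightarrow> bool" where
  "peak_free p \<longleftrightarrow> p \<noteq> [] \<and> \<not> (\<exists>i. Suc i < length p \<and> p ! i = Up \<and> p ! Suc i = Down)"

definition peak_free_motzkin_paths :: "'x set \<Rightarrow> 'w set \<Rightarrow> (('x, 'w) dstep list, 'w) operated" where
  "peak_free_motzkin_paths X \<Omega> = (motzkin_paths X \<Omega>)
     \<lparr>carrier := {p \<in> carrier (motzkin_paths X \<Omega>). peak_free (map undecorate p)}\<rparr>"

end

theory Submission
  imports Defs
begin

text \<open>A bracketed word is a nested expression, and Motzkin words and decorated Motzkin paths are two
  ways of writing such an expression as a flat string: replace every bracket by an opening symbol, the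
  flattened contents, and a closing symbol. This flattening, \<open>spell\<close>, is by construction
  a homomorphism that respects the operators and the generators. So all that has to be shown is
  that it is injective and that its image is the right one.

  Injectivity is unique readability (\<open>spell_prefix_unique\<close>). When a flattened word is
  followed by a closing symbol or by nothing, that point is where the word must end, so the word
  can be recovered from left to right, given that generators, opening symbols and closing symbols
  can be told apart. Motzkin words and Motzkin paths are both instances, with slashes and
  with decorated steps as symbols.

  For Motzkin words the image is right because bracketed words are generated from the letters by
  product and operators, so that their image is the least operated submonoid containing the
  letters.

  For Motzkin paths one has to pass from the geometric definition to the recursive one. The key
  is the decomposition at the first return: a path that starts with an up step comes back to
  height 0 for the first time at a unique down step, which is the only step matching it
  (\<open>path_from_split\<close>, \<open>first_return_unique\<close>). Existence of the first return
  lets one read off a bracketed word from a path by induction on its length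
  (\<open>nested_path_is_spelled\<close>); its uniqueness shows that in a flattened word the matching
  pairs are exactly the pairs that come from one bracket, so that the decorations agree
  (\<open>matching_in_spell\<close>).

  A peak is a matching pair with nothing in between, hence comes from an empty bracket. Peak-free
  paths therefore correspond to words without empty brackets, and these are what the semigroup
  construction produces. To treat both cases at once, a Boolean \<open>e\<close> records whether
  empty brackets are allowed.\<close>

section \<open>Bracketed words as an inductive set\<close>

text \<open>The flag \<open>e\<close> says whether brackets may be empty. The empty word itself belongs to the set
  for either value of \<open>e\<close>, so that words can always be built up one letter at a time; for
  the semigroup it is removed at the end.\<close>

inductive_set bracketed_words :: "bool \<Rightarrow> 'x set \<Rightarrow> 'w set \<Rightarrow> ('x, 'w) bletter list set"
  for e :: bool and X :: "'x set" and \<Omega> :: "'w set"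
where
  Nil: "[] \<in> bracketed_words e X \<Omega>"
| Gen: "\<lbrakk>x \<in> X; u \<in> bracketed_words e X \<Omega>\<rbrakk> \<Longrightarrow> Gen x # u \<in> bracketed_words e X \<Omega>"
| Bracket: "\<lbrakk>\<omega> \<in> \<Omega>; m \<in> bracketed_words e X \<Omega>; m = [] \<Longrightarrow> e; u \<in> bracketed_words e X \<Omega>\<rbrakk>
    \<Longrightarrow> Bracket \<omega> m # u \<in> bracketed_words e X \<Omega>"

lemma bracketed_words_append:
  assumes "u \<in> bracketed_words e X \<Omega>" "v \<in> bracketed_words e X \<Omega>"
  shows "u @ v \<in> bracketed_words e X \<Omega>"
  using assms by induction (auto intro: bracketed_words.intros)

lemma letter_lists_mono:
  "A \<subseteq> B \<Longrightarrow> lists (Gen ` X \<union> (\<Union>\<omega>\<in>\<Omega>. Bracket \<omega> ` A)) \<subseteq> lists (Gen ` X \<union> (\<Union>\<omega>\<in>\<Omega>. Bracket \<omega> ` B))"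
  by (intro lists_mono) blast

lemma M_stage_mono: "n \<le> k \<Longrightarrow> M_stage X \<Omega> n \<subseteq> M_stage X \<Omega> k"
proof (rule lift_Suc_mono_le[of "M_stage X \<Omega>"])
  fix n show "M_stage X \<Omega> n \<subseteq> M_stage X \<Omega> (Suc n)"
  proof (induction n)
    case 0
    show ?case unfolding M_stage.simps by (intro lists_mono) blast
  next
    case (Suc n)
    from letter_lists_mono[OF Suc, of X \<Omega>] show ?case by (simp only: M_stage.simps)
  qed
qed

lemma S_stage_mono: "n \<le> k \<Longrightarrow> S_stage X \<Omega> n \<subseteq> S_stage X \<Omega> k"
proof (rule lift_Suc_mono_le[of "S_stage X \<Omega>"])
  fix n show "S_stage X \<Omega> n \<subseteq> S_stage X \<Omega> (Suc n)"
  proof (induction n)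
    case 0
    show ?case unfolding S_stage.simps by (intro lists_mono Diff_mono) blast+
  next
    case (Suc n)
    from Diff_mono[OF letter_lists_mono[OF Suc, of X \<Omega>] order_refl] show ?case
      by (simp only: S_stage.simps)
  qed
qed

lemma Union_M_stage: "(\<Union>n. M_stage X \<Omega> n) = bracketed_words True X \<Omega>"
proof (intro equalityI subsetI)
  fix u assume "u \<in> (\<Union>n. M_stage X \<Omega> n)"
  then obtain n where "u \<in> M_stage X \<Omega> n" by blast
  then show "u \<in> bracketed_words True X \<Omega>"
  proof (induction n arbitrary: u)
    case 0
    then show ?case by (induction u) (auto intro: bracketed_words.intros)
  next
    case (Suc n)
    from Suc.prems have "u \<in> lists (Gen ` X \<union> (\<Union>\<omega>\<in>\<Omega>. Bracket \<omega> ` M_stage X \<Omega> n))" by simp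
    then show ?case
      by (induction u) (auto intro!: bracketed_words.intros dest!: Suc.IH)
  qed
next
  fix u assume "u \<in> bracketed_words True X \<Omega>"
  then have "\<exists>n. u \<in> M_stage X \<Omega> n"
  proof induction
    case Nil
    then show ?case by (intro exI[of _ 0]) simp
  next
    case (Gen x u)
    then obtain n where "u \<in> M_stage X \<Omega> n" by blast
    then have "Gen x # u \<in> M_stage X \<Omega> n" using Gen by (cases n) auto
    then show ?case ..
  next
    case (Bracket \<omega> m u)
    then obtain j k where "m \<in> M_stage X \<Omega> j" "u \<in> M_stage X \<Omega> k" by blast
    then have "m \<in> M_stage X \<Omega> (max j k)" "u \<in> M_stage X \<Omega> (Suc (max j k))"
      using M_stage_mono[of j "max j k" X \<Omega>] M_stage_mono[of k "Suc (max j k)" X \<Omega>]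
      by (simp_all only: max.cobounded1 max.cobounded2 le_SucI simp_thms) blast+
    then have "Bracket \<omega> m # u \<in> M_stage X \<Omega> (Suc (max j k))" using Bracket by auto
    then show ?case ..
  qed
  then show "u \<in> (\<Union>n. M_stage X \<Omega> n)" by blast
qed

lemma Union_S_stage: "(\<Union>n. S_stage X \<Omega> n) = bracketed_words False X \<Omega> - {[]}"
proof (intro equalityI subsetI)
  fix u assume "u \<in> (\<Union>n. S_stage X \<Omega> n)"
  then obtain n where n: "u \<in> S_stage X \<Omega> n" by blast
  then have "u \<in> bracketed_words False X \<Omega> \<and> u \<noteq> []"
  proof (induction n arbitrary: u)
    case 0
    have "u \<in> lists (Gen ` X) \<Longrightarrow> u \<in> bracketed_words False X \<Omega>"
      by (induction u) (auto intro: bracketed_words.intros)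
    with 0 show ?case by simp
  next
    case (Suc n)
    have "u \<in> lists (Gen ` X \<union> (\<Union>\<omega>\<in>\<Omega>. Bracket \<omega> ` S_stage X \<Omega> n)) \<Longrightarrow> u \<in> bracketed_words False X \<Omega>"
      by (induction u) (auto intro!: bracketed_words.intros dest!: Suc.IH)
    with Suc.prems show ?case by simp
  qed
  then show "u \<in> bracketed_words False X \<Omega> - {[]}" by simp
next
  fix u assume "u \<in> bracketed_words False X \<Omega> - {[]}"
  then have "u \<in> bracketed_words False X \<Omega>" "u \<noteq> []" by auto
  from this(1) have "\<exists>n. u = [] \<or> u \<in> S_stage X \<Omega> n"
  proof induction
    case Nil
    then show ?case by simp
  next
    case (Gen x u)
    then obtain n where "u = [] \<or> u \<in> S_stage X \<Omega> n" by blast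
    then have "Gen x # u \<in> S_stage X \<Omega> n" using Gen by (cases n) auto
    then show ?case by blast
  next
    case (Bracket \<omega> m u)
    then obtain j k where "m \<in> S_stage X \<Omega> j" "u = [] \<or> u \<in> S_stage X \<Omega> k" by blast
    then have "m \<in> S_stage X \<Omega> (max j k)" "u = [] \<or> u \<in> S_stage X \<Omega> (Suc (max j k))"
      using S_stage_mono[of j "max j k" X \<Omega>] S_stage_mono[of k "Suc (max j k)" X \<Omega>]
      by (simp_all only: max.cobounded1 max.cobounded2 le_SucI simp_thms) blast+
    then have "Bracket \<omega> m # u \<in> S_stage X \<Omega> (Suc (max j k))" using Bracket by auto
    then show ?case by blast
  qed
  with \<open>u \<noteq> []\<close> show "u \<in> (\<Union>n. S_stage X \<Omega> n)" by blast
qed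


section \<open>Flattening bracketed words\<close>

text \<open>These are the distinctions that reading from left to right relies on. The index of a bracket
  is read off its opening symbol.\<close>

locale bracket_alphabet =
  fixes l :: "'x \<Rightarrow> 'c" and a b :: "'w \<Rightarrow> 'c"
  assumes inj_l: "inj l" and inj_a: "inj a"
    and l_neq_a: "l x \<noteq> a \<omega>" and l_neq_b: "l x \<noteq> b \<omega>" and a_neq_b: "a \<omega> \<noteq> b \<omega>'"
begin

fun spell :: "('x, 'w) bletter list \<Rightarrow> 'c list" where
  "spell [] = []"
| "spell (Gen x # u) = l x # spell u"
| "spell (Bracket \<omega> m # u) = a \<omega> # spell m @ b \<omega> # spell u"

lemma spell_append: "spell (u @ v) = spell u @ spell v"
  by (induction u rule: spell.induct) auto

lemma spell_eq_Nil_iff: "spell u = [] \<longleftrightarrow> u = []"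
  by (cases u rule: spell.cases) auto

text \<open>Injectivity alone is too weak for the induction: the contents of a bracket are followed by a
  closing symbol and further text. The remainders \<open>s\<close> and \<open>t\<close> account for that;
  as no flattened word starts with a closing symbol, a remainder that does cannot be confused with
  a continuation of the word.\<close>

lemma spell_prefix_unique:
  assumes "spell u @ s = spell v @ t"
    and "s = [] \<or> hd s \<in> range b" "t = [] \<or> hd t \<in> range b"
  shows "u = v \<and> s = t"
  using assms
proof (induction u arbitrary: v s t rule: spell.induct)
  case (1 v s t)
  then show ?case
    using l_neq_b a_neq_b by (cases v rule: spell.cases) auto
next
  case (2 x u v s t)
  show ?case
  proof (cases v rule: spell.cases)
    case 1
    then show ?thesis using "2.prems" l_neq_b by auto
  next
    case (2 y v')
    then show ?thesis using "2.prems" "2.IH"[of s v' t] inj_l by (auto dest: injD)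
  next
    case 3
    then show ?thesis using "2.prems" l_neq_a by auto
  qed
next
  case (3 \<omega> m u v s t)
  show ?case
  proof (cases v rule: spell.cases)
    case 1
    then show ?thesis using "3.prems" a_neq_b by auto
  next
    case 2
    then show ?thesis using "3.prems" l_neq_a[symmetric] by auto
  next
    case (3 \<omega>' m' v')
    then have "\<omega> = \<omega>'"
      and tail: "spell m @ (b \<omega> # spell u @ s) = spell m' @ (b \<omega>' # spell v' @ t)"
      using "3.prems"(1) inj_a by (auto dest: injD)
    from "3.IH"(1)[OF tail] have "m = m'" and rest: "spell u @ s = spell v' @ t" by auto
    from "3.IH"(2)[OF rest "3.prems"(2,3)] show ?thesis using 3 \<open>\<omega> = \<omega>'\<close> \<open>m = m'\<close> by simp
  qed
qed

lemma inj_spell: "inj spell"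
  using spell_prefix_unique[of _ "[]" _ "[]"] by (auto intro: injI)

text \<open>The first form serves the semigroup, from which the empty word is removed, the second one
  the monoid.\<close>

lemma spell_bracket_mem:
  assumes "\<omega> \<in> \<Omega>" "p \<in> spell ` bracketed_words e X \<Omega>" "p = [] \<Longrightarrow> e"
  shows "a \<omega> # p @ [b \<omega>] \<in> spell ` (bracketed_words e X \<Omega> - {[]})"
    and "a \<omega> # p @ [b \<omega>] \<in> spell ` bracketed_words e X \<Omega>"
proof -
  from assms(2) obtain m where "m \<in> bracketed_words e X \<Omega>" "p = spell m" by blast
  with assms(1,3) show "a \<omega> # p @ [b \<omega>] \<in> spell ` (bracketed_words e X \<Omega> - {[]})"
    by (intro image_eqI[of _ _ "[Bracket \<omega> m]"]) (auto intro!: bracketed_words.intros)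
  then show "a \<omega> # p @ [b \<omega>] \<in> spell ` bracketed_words e X \<Omega>" by blast
qed

lemma operated_monoid_iso_spell:
  "operated_monoid_iso \<Omega> (bracketed_monoid X \<Omega>)
     \<lparr>carrier = spell ` bracketed_words True X \<Omega>, mult = (@), one = [],
      oper = (\<lambda>\<omega> m. [a \<omega>] @ m @ [b \<omega>])\<rparr> spell"
  unfolding bracketed_monoid_def Union_M_stage
  by unfold_locales
    (auto simp: hom_def spell_append[symmetric] bij_betw_def inj_on_subset[OF inj_spell]
       intro!: bracketed_words.intros bracketed_words_append spell_bracket_mem image_eqI[of "[]" _ "[]"]
       intro: imageI)

lemma operated_semigroup_iso_spell:
  "operated_semigroup_iso \<Omega> (bracketed_semigroup X \<Omega>)
     \<lparr>carrier = spell ` (bracketed_words False X \<Omega> - {[]}), mult = (@), one = [],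
      oper = (\<lambda>\<omega> m. [a \<omega>] @ m @ [b \<omega>])\<rparr> spell"
  unfolding bracketed_semigroup_def Union_S_stage
  by unfold_locales
    (auto simp: hom_def spell_append[symmetric] bij_betw_def inj_on_subset[OF inj_spell]
       spell_eq_Nil_iff intro!: bracketed_words.intros bracketed_words_append spell_bracket_mem
       intro: imageI)

end


section \<open>Motzkin words\<close>

interpretation word: bracket_alphabet Letter Slash Backslash
  by unfold_locales (auto intro: injI)

text \<open>Both inclusions express generation by \<open>X\<close>: the flattened words form an operated submonoid
  that contains the letters, and by induction on bracketed words every other such submonoid
  contains them all.\<close>

lemma carrier_motzkin_words:
  "carrier (motzkin_words X \<Omega>) = word.spell ` bracketed_words True X \<Omega>"
proof -
  let ?W = "bracketed_words True X \<Omega>"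
  have "operated_submonoid \<Omega> (word.spell ` ?W) (slash_monoid X \<Omega>)"
  proof
    have "set (word.spell u) \<subseteq> Letter ` X \<union> Slash ` \<Omega> \<union> Backslash ` \<Omega>" if "u \<in> ?W" for u
      using that by induction auto
    then show "word.spell ` ?W \<subseteq> carrier (slash_monoid X \<Omega>)"
      by (auto simp: slash_monoid_def)
  next
    fix x y assume "x \<in> word.spell ` ?W" "y \<in> word.spell ` ?W"
    then show "x \<otimes>\<^bsub>slash_monoid X \<Omega>\<^esub> y \<in> word.spell ` ?W"
      by (auto simp: slash_monoid_def word.spell_append[symmetric] intro!: imageI bracketed_words_append)
  next
    show "\<one>\<^bsub>slash_monoid X \<Omega>\<^esub> \<in> word.spell ` ?W"
      by (auto simp: slash_monoid_def intro!: image_eqI[of _ _ "[]"] bracketed_words.Nil)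
  next
    fix \<omega> x assume "\<omega> \<in> \<Omega>" "x \<in> word.spell ` ?W"
    then obtain u where "u \<in> ?W" "x = word.spell u" by auto
    then show "oper (slash_monoid X \<Omega>) \<omega> x \<in> word.spell ` ?W" using \<open>\<omega> \<in> \<Omega>\<close>
      by (auto simp: slash_monoid_def intro!: image_eqI[of _ _ "[Bracket \<omega> u]"] bracketed_words.intros)
  qed
  moreover have "(\<lambda>x. [Letter x]) ` X \<subseteq> word.spell ` ?W"
    by (auto intro!: image_eqI[of _ _ "[Gen _]"] bracketed_words.intros)
  moreover have "word.spell ` ?W \<subseteq> H"
    if "operated_submonoid \<Omega> H (slash_monoid X \<Omega>)" and gens: "(\<lambda>x. [Letter x]) ` X \<subseteq> H" for H
  proof -
    interpret operated_submonoid \<Omega> H "slash_monoid X \<Omega>" by fact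
    have mult: "p @ q \<in> H" if "p \<in> H" "q \<in> H" for p q
      using m_closed[OF that] by (simp add: slash_monoid_def)
    have "word.spell u \<in> H" if "u \<in> ?W" for u
      using that
    proof induction
      case Nil
      then show ?case using one_closed by (simp add: slash_monoid_def)
    next
      case (Gen x u)
      then show ?case using gens mult[of "[Letter x]" "word.spell u"] by auto
    next
      case (Bracket \<omega> m u)
      then have "Slash \<omega> # word.spell m @ [Backslash \<omega>] \<in> H"
        using oper_closed[of \<omega> "word.spell m"] by (simp add: slash_monoid_def)
      from mult[OF this Bracket.IH(2)] show ?case by simp
    qed
    then show ?thesis by blast
  qed
  ultimately show ?thesis
    unfolding motzkin_words_def by (simp add: hull_def) blast
qed

lemma motzkin_words_eq:
  "motzkin_words X \<Omega> =
     \<lparr>carrier = word.spell ` bracketed_words True X \<Omega>, mult = (@), one = [],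
      oper = (\<lambda>\<omega> m. [Slash \<omega>] @ m @ [Backslash \<omega>])\<rparr>"
  unfolding carrier_motzkin_words[symmetric]
  by (simp add: motzkin_words_def slash_monoid_def)


section \<open>Heights of lattice paths\<close>

text \<open>Such a path starts at height \<open>h\<close>, never goes below the axis and ends on it. Letting the
  starting height vary is what makes the notion recursive in the list of steps.\<close>

fun path_from :: "nat \<Rightarrow> step list \<Rightarrow> bool" where
  "path_from h [] \<longleftrightarrow> h = 0"
| "path_from h (Up # p) \<longleftrightarrow> path_from (Suc h) p"
| "path_from h (Level # p) \<longleftrightarrow> path_from h p"
| "path_from 0 (Down # p) \<longleftrightarrow> False"
| "path_from (Suc h) (Down # p) \<longleftrightarrow> path_from h p"

text \<open>Every step moves one unit to the right, so the abscissa carries no information and only heights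
  matter.\<close>

lemma fst_vertex: "k \<le> length p \<Longrightarrow> fst (vertex p k) = int k"
proof -
  have "fst (sum_list (map direction p)) = int (length p)" for p
  proof (induction p)
    case (Cons s p)
    then show ?case by (cases s) auto
  qed (simp add: zero_prod_def)
  from this[of "take k p"] show "k \<le> length p \<Longrightarrow> ?thesis" by (simp add: vertex_def)
qed

lemma all_le_Suc: "(\<forall>k\<le>Suc n. Q k) \<longleftrightarrow> Q 0 \<and> (\<forall>k\<le>n. Q (Suc k))"
  by auto (metis Suc_le_mono not0_implies_Suc)

lemma snd_vertex_0: "snd (vertex p 0) = 0"
  by (simp add: vertex_def)

lemma snd_vertex_Suc: "snd (vertex (s # p) (Suc k)) = snd (direction s) + snd (vertex p k)"
  by (simp add: vertex_def)

lemma path_from_iff: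
  "path_from h p \<longleftrightarrow>
     (\<forall>k\<le>length p. 0 \<le> int h + snd (vertex p k)) \<and> int h + snd (vertex p (length p)) = 0"
proof (induction h p rule: path_from.induct)
  case (4 p)
  \<comment> \<open>The vertex after the first step is below the axis.\<close>
  have "\<not> (\<forall>k\<le>length p. 0 \<le> -1 + snd (vertex p k))"
    by (intro notI) (drule spec[of _ 0], simp add: snd_vertex_0)
  then show ?case by (auto simp: all_le_Suc snd_vertex_0 snd_vertex_Suc)
qed (simp_all add: all_le_Suc snd_vertex_0 snd_vertex_Suc algebra_simps)

lemma motzkin_path_iff: "motzkin_path p \<longleftrightarrow> path_from 0 p"
proof -
  have "vertex p k \<in> {0..} \<times> {0..} \<longleftrightarrow> 0 \<le> snd (vertex p k)" if "k \<le> length p" for k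
    using fst_vertex[OF that] by (cases "vertex p k") auto
  moreover have "(\<exists>n\<ge>0. vertex p (length p) = (n, 0)) \<longleftrightarrow> snd (vertex p (length p)) = 0"
    using fst_vertex[of "length p" p] by (cases "vertex p (length p)") auto
  ultimately show ?thesis by (simp add: motzkin_path_def path_from_iff)
qed

text \<open>A path from height \<open>h\<close> to the axis descends by \<open>h\<close> overall. Started \<open>k\<close>
  units higher it stays above height \<open>k\<close> and arrives there.\<close>

lemma path_from_append:
  assumes "path_from h p"
  shows "path_from (h + k) (p @ q) \<longleftrightarrow> path_from k q"
  using assms by (induction h p rule: path_from.induct) auto

lemma path_from_close:
  "path_from 0 p \<Longrightarrow> path_from (Suc k) (p @ Down # q) \<longleftrightarrow> path_from k q"
  using path_from_append[of 0 p "Suc k" "Down # q"] by simp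

text \<open>A path from height \<open>h + Suc k\<close> has to cross from \<open>Suc k\<close> to \<open>k\<close>; the split
  is at the first such step. For \<open>h = 0\<close> this is the first return after an up step. The
  induction needs general \<open>h\<close>, since the height varies before the crossing.\<close>

lemma path_from_split:
  assumes "path_from (h + Suc k) p"
  shows "\<exists>m q. p = m @ Down # q \<and> path_from h m \<and> path_from k q"
  using assms
proof (induction h p rule: path_from.induct)
  case (2 h p)
  then obtain m q where "p = m @ Down # q \<and> path_from (Suc h) m \<and> path_from k q" by auto
  then show ?case by (intro exI[of _ "Up # m"] exI[of _ q]) simp
next
  case (3 h p)
  then obtain m q where "p = m @ Down # q \<and> path_from h m \<and> path_from k q" by auto
  then show ?case by (intro exI[of _ "Level # m"] exI[of _ q]) simp
next
  case (4 p)
  then show ?case by (intro exI[of _ "[]"] exI[of _ p]) simp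
next
  case (5 h p)
  then obtain m q where "p = m @ Down # q \<and> path_from h m \<and> path_from k q" by auto
  then show ?case by (intro exI[of _ "Down # m"] exI[of _ q]) simp
qed simp

text \<open>After \<open>m\<close> the path is on the axis, so the following down step leaves the upper half plane.
  Neither of \<open>m\<close> and \<open>m'\<close> can therefore extend the other.\<close>

lemma first_return_unique:
  assumes "path_from h m" "path_from h m'" "m @ Down # q = m' @ Down # q'"
  shows "m = m'"
  using assms
proof (induction h m arbitrary: m' rule: path_from.induct)
  case (1 h m')
  then show ?case by (cases m') auto
next
  case (2 h p m')
  from "2.prems" obtain p' where "m' = Up # p'" by (cases m') auto
  with 2 show ?case by simp
next
  case (3 h p m')
  from "3.prems" obtain p' where "m' = Level # p'" by (cases m') auto
  with 3 show ?case by simp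
next
  case (4 p m')
  then show ?case by simp
next
  case (5 h p m')
  from "5.prems" obtain p' where "m' = Down # p'" by (cases m') auto
  with 5 show ?case by simp
qed


section \<open>Decorated paths as flattened words\<close>

text \<open>The condition on matching pairs, expressed by factorisations of the list instead of positions in
  it. Factorisations are inherited by factors at once, and they fit recursion on lists.\<close>

definition matched :: "'w set \<Rightarrow> ('x, 'w) dstep list \<Rightarrow> bool" where
  "matched \<Omega> p \<longleftrightarrow>
     (\<forall>r s m t q. p = r @ s # m @ t # q \<and> undecorate s = Up \<and> undecorate t = Down \<and>
        path_from 0 (map undecorate m) \<longrightarrow> (\<exists>\<omega>\<in>\<Omega>. s = DUp \<omega> \<and> t = DDown \<omega>))"

definition peakless :: "('x, 'w) dstep list \<Rightarrow> bool" where
  "peakless p \<longleftrightarrow> (\<nexists>r s t q. p = r @ s # t # q \<and> undecorate s = Up \<and> undecorate t = Down)"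

text \<open>These conditions characterise the flattened bracketed words among the lists of decorated
  steps whose underlying path is a Motzkin path; the flag \<open>e\<close> has the same meaning as for
  bracketed words.\<close>

definition nested :: "bool \<Rightarrow> 'x set \<Rightarrow> 'w set \<Rightarrow> ('x, 'w) dstep list \<Rightarrow> bool" where
  "nested e X \<Omega> p \<longleftrightarrow> matched \<Omega> p \<and> (e \<or> peakless p) \<and> {x. DLevel x \<in> set p} \<subseteq> X"

lemma matchedD:
  assumes "matched \<Omega> (r @ s # m @ t # q)" "undecorate s = Up" "undecorate t = Down"
    "path_from 0 (map undecorate m)"
  shows "\<exists>\<omega>\<in>\<Omega>. s = DUp \<omega> \<and> t = DDown \<omega>"
  using assms unfolding matched_def by blast

lemma matched_factor:
  assumes "matched \<Omega> (p @ m @ q)"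
  shows "matched \<Omega> m"
  unfolding matched_def
proof (intro allI impI, elim conjE)
  fix r s n t z
  assume "m = r @ s # n @ t # z" and st: "undecorate s = Up" "undecorate t = Down"
    "path_from 0 (map undecorate n)"
  with assms have "matched \<Omega> ((p @ r) @ s # n @ t # (z @ q))" by simp
  then show "\<exists>\<omega>\<in>\<Omega>. s = DUp \<omega> \<and> t = DDown \<omega>" using st by (rule matchedD)
qed

lemma peakless_factor:
  assumes "peakless (p @ m @ q)"
  shows "peakless m"
  unfolding peakless_def
proof (intro notI, elim exE conjE)
  fix r s t z
  assume "m = r @ s # t # z" and st: "undecorate s = Up" "undecorate t = Down"
  then have "p @ m @ q = (p @ r) @ s # t # (z @ q)" by simp
  with assms st show False unfolding peakless_def by blast
qed

lemma nested_factor: "nested e X \<Omega> (p @ m @ q) \<Longrightarrow> nested e X \<Omega> m"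
  unfolding nested_def by (auto dest: matched_factor peakless_factor)

interpretation path: bracket_alphabet DLevel DUp DDown
  by unfold_locales (auto intro: injI)

lemma path_from_spell: "path_from 0 (map undecorate (path.spell u))"
  by (induction u rule: path.spell.induct) (auto simp: path_from_close)

text \<open>The up step \<open>s\<close> comes from an opening symbol somewhere in \<open>u\<close>. The contents of that
  bracket form a Motzkin path followed by a down step, and so does \<open>m\<close>, so by uniqueness of
  the first return the two coincide. The trailing list \<open>z\<close> is there for the induction:
  inside a bracket, the text goes on with the closing symbol and whatever follows it.\<close>

lemma matching_in_spell:
  assumes "u \<in> bracketed_words e X \<Omega>"
    and "path.spell u @ z = r @ s # m @ t # q" "length r < length (path.spell u)"
    and "undecorate s = Up" "undecorate t = Down" "path_from 0 (map undecorate m)"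
  shows "(\<exists>\<omega>\<in>\<Omega>. s = DUp \<omega> \<and> t = DDown \<omega>) \<and> (m = [] \<longrightarrow> e)"
  using assms(1-3)
proof (induction arbitrary: z r)
  case Nil
  then show ?case by simp
next
  case (Gen x u)
  then show ?case using assms(4) by (cases r) auto
next
  case (Bracket \<omega> v u)
  show ?case
  proof (cases r)
    case Nil
    with Bracket.prems have s: "s = DUp \<omega>"
      and tail: "path.spell v @ DDown \<omega> # path.spell u @ z = m @ t # q" by auto
    have "map undecorate (path.spell v) @ Down # map undecorate (path.spell u @ z) =
        map undecorate m @ Down # map undecorate q"
      using arg_cong[OF tail, of "map undecorate"] assms(5) by simp
    then have "map undecorate (path.spell v) = map undecorate m"
      by (rule first_return_unique[OF path_from_spell assms(6)])
    then have "length (path.spell v) = length m" by (rule map_eq_imp_length_eq)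
    with tail have "path.spell v = m" "t = DDown \<omega>" by auto
    with s Bracket.hyps show ?thesis by (auto simp: path.spell_eq_Nil_iff)
  next
    case (Cons c r')
    with Bracket.prems have
      tail: "path.spell v @ DDown \<omega> # path.spell u @ z = r' @ s # m @ t # q" by simp
    consider "length r' < length (path.spell v)" | "length r' = length (path.spell v)"
      | "length r' > length (path.spell v)" by linarith
    \<comment> \<open>The up step lies inside the bracket, at its closing symbol, or behind it.\<close>
    then show ?thesis
    proof cases
      case 1
      with Bracket.IH(1)[OF tail] show ?thesis .
    next
      case 2
      with tail have "s = DDown \<omega>" by auto
      with assms(4) show ?thesis by simp
    next
      case 3
      with tail obtain r'' where r': "r' = path.spell v @ DDown \<omega> # r''"
        by (auto simp: append_eq_append_conv2 Cons_eq_append_conv)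
      with tail have "path.spell u @ z = r'' @ s # m @ t # q" by simp
      moreover have "length r'' < length (path.spell u)"
        using Bracket.prems(2) Cons r' by simp
      ultimately show ?thesis by (rule Bracket.IH(2))
    qed
  qed
qed

lemma nested_spell:
  assumes "u \<in> bracketed_words e X \<Omega>"
  shows "nested e X \<Omega> (path.spell u)"
proof -
  have match: "(\<exists>\<omega>\<in>\<Omega>. s = DUp \<omega> \<and> t = DDown \<omega>) \<and> (m = [] \<longrightarrow> e)"
    if "path.spell u = r @ s # m @ t # q" "undecorate s = Up" "undecorate t = Down"
      "path_from 0 (map undecorate m)" for r s m t q
    using matching_in_spell[OF assms, of "[]" r s m t q] that by simp
  have "matched \<Omega> (path.spell u)"
    unfolding matched_def using match by blast
  moreover have "e \<or> peakless (path.spell u)"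
    unfolding peakless_def using match[where m = "[]"] by auto
  moreover have "x \<in> X" if "DLevel x \<in> set (path.spell u)" for x
    using assms that by induction auto
  ultimately show ?thesis
    unfolding nested_def by blast
qed

text \<open>A path is empty, or starts with a level step, or starts with an up step. In the last case it is
  cut at the first return, and the two pieces are shorter decorated paths.\<close>

lemma nested_path_is_spelled:
  assumes "path_from 0 (map undecorate p)" "nested e X \<Omega> p"
  shows "p \<in> path.spell ` bracketed_words e X \<Omega>"
  using assms
proof (induction p rule: length_induct)
  case (1 p)
  show ?case
  proof (cases p)
    case Nil
    then show ?thesis by (auto intro!: image_eqI[of _ _ "[]"] bracketed_words.Nil)
  next
    case (Cons s p')
    show ?thesis
    proof (cases s)
      case (DLevel x)
      have "nested e X \<Omega> p'" using nested_factor[of e X \<Omega> "[s]" p' "[]"] 1 Cons by simp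
      moreover have "path_from 0 (map undecorate p')" using 1 Cons DLevel by simp
      ultimately obtain u where "u \<in> bracketed_words e X \<Omega>" "p' = path.spell u"
        using 1 Cons by auto
      moreover have "x \<in> X" using 1 Cons DLevel by (auto simp: nested_def)
      ultimately show ?thesis using Cons DLevel
        by (auto intro!: image_eqI[of _ _ "Gen x # u"] bracketed_words.intros)
    next
      case (DDown \<omega>)
      with 1 Cons show ?thesis by simp
    next
      case (DUp \<omega>)
      with 1 Cons have "path_from (0 + Suc 0) (map undecorate p')" by simp
      then obtain m' q' where split: "map undecorate p' = m' @ Down # q'"
        and m'q': "path_from 0 m'" "path_from 0 q'" by (blast dest: path_from_split)
      from split obtain m t q where p': "p' = m @ t # q" and t: "undecorate t = Down"
        and mq: "m' = map undecorate m" "q' = map undecorate q"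
        by (auto simp: map_eq_append_conv)
      have p: "p = [] @ s # m @ t # q" using Cons p' by simp
      have "nested e X \<Omega> p" using 1 by blast
      then have "\<exists>\<omega>\<in>\<Omega>. s = DUp \<omega> \<and> t = DDown \<omega>" and "e \<or> peakless p"
        using matchedD[of \<Omega> "[]" s m t q] p DUp t m'q'(1) mq(1) by (simp_all add: nested_def)
      moreover have "m \<noteq> []" if "peakless p"
      proof
        assume "m = []"
        then have "p = [] @ s # t # q" using p by simp
        with that DUp t show False unfolding peakless_def by fastforce
      qed
      ultimately have tD: "t = DDown \<omega>" and "\<omega> \<in> \<Omega>" and ne: "m = [] \<Longrightarrow> e" using DUp by auto
      have "nested e X \<Omega> m" "nested e X \<Omega> q"
        using \<open>nested e X \<Omega> p\<close> nested_factor[of e X \<Omega> "[s]" m "t # q"]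
          nested_factor[of e X \<Omega> "s # m @ [t]" q "[]"] p by simp_all
      moreover have "length m < length p" "length q < length p" using p by simp_all
      ultimately have "m \<in> path.spell ` bracketed_words e X \<Omega>" "q \<in> path.spell ` bracketed_words e X \<Omega>"
        using "1.IH" m'q' mq by blast+
      then obtain v u where "v \<in> bracketed_words e X \<Omega>" "m = path.spell v"
        "u \<in> bracketed_words e X \<Omega>" "q = path.spell u" by blast
      with p DUp tD \<open>\<omega> \<in> \<Omega>\<close> ne show ?thesis
        by (auto intro!: image_eqI[of _ _ "Bracket \<omega> v # u"] bracketed_words.intros)
    qed
  qed
qed

lemma spell_image_bracketed_words:
  "path.spell ` bracketed_words e X \<Omega> = {p. path_from 0 (map undecorate p) \<and> nested e X \<Omega> p}"
  using path_from_spell nested_spell nested_path_is_spelled by blast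

lemma matching_pair_iff:
  "matching_pair p i j \<longleftrightarrow>
     (\<exists>r m q. p = r @ Up # m @ Down # q \<and> path_from 0 m \<and> i = length r \<and> j = length r + Suc (length m))"
proof
  assume *: "matching_pair p i j"
  then have ij: "i < j" "j < length p" and *: "p ! i = Up" "p ! j = Down"
    "path_from 0 (take (j - Suc i) (drop (Suc i) p))"
    by (auto simp: matching_pair_def motzkin_path_iff)
  have "p = take i p @ Up # drop (Suc i) p" using ij * by (metis id_take_nth_drop less_trans)
  moreover have "drop (Suc i) p = take (j - Suc i) (drop (Suc i) p) @ Down # drop (Suc j) p"
    using id_take_nth_drop[of "j - Suc i" "drop (Suc i) p"] ij * by simp
  ultimately have "p = take i p @ Up # take (j - Suc i) (drop (Suc i) p) @ Down # drop (Suc j) p"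
    by simp
  with * ij show "\<exists>r m q. p = r @ Up # m @ Down # q \<and> path_from 0 m \<and>
      i = length r \<and> j = length r + Suc (length m)"
    by (intro exI[of _ "take i p"] exI[of _ "take (j - Suc i) (drop (Suc i) p)"]
        exI[of _ "drop (Suc j) p"] conjI) simp_all
qed (auto simp: matching_pair_def motzkin_path_iff nth_append)

text \<open>Decorations are forgotten step by step, so a factorisation of the underlying path lifts to
  the decorated path.\<close>

lemma map_undecorate_factor:
  "map undecorate p = r' @ Up # m' @ Down # q' \<longleftrightarrow>
     (\<exists>r s m t q. p = r @ s # m @ t # q \<and> undecorate s = Up \<and> undecorate t = Down \<and>
        r' = map undecorate r \<and> m' = map undecorate m \<and> q' = map undecorate q)"
    (is "_ \<longleftrightarrow> ?factored")
proof
  assume "map undecorate p = r' @ Up # m' @ Down # q'"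
  then obtain r s m t q where "p = r @ s # m @ t # q" "undecorate s = Up" "undecorate t = Down"
    "r' = map undecorate r" "m' = map undecorate m" "q' = map undecorate q"
    by (auto simp: map_eq_append_conv append_eq_map_conv Cons_eq_map_conv)
  then show ?factored by blast
qed auto

lemma decorated_motzkin_path_iff:
  fixes X :: "'x set" and \<Omega> :: "'w set" and p :: "('x, 'w) dstep list"
  shows "decorated_motzkin_path X \<Omega> p \<longleftrightarrow> path_from 0 (map undecorate p) \<and> nested True X \<Omega> p"
proof -
  have "(\<forall>i j. matching_pair (map undecorate p) i j \<longrightarrow> (\<exists>\<omega>\<in>\<Omega>. p ! i = DUp \<omega> \<and> p ! j = DDown \<omega>)) \<longleftrightarrow>
     matched \<Omega> p" (is "?pairs \<longleftrightarrow> _")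
  proof
    assume ?pairs
    show "matched \<Omega> p"
      unfolding matched_def
    proof (intro allI impI, elim conjE)
      fix r s m t q
      assume p: "p = r @ s # m @ t # q" and *: "undecorate s = Up" "undecorate t = Down"
        "path_from 0 (map undecorate m)"
      then have "matching_pair (map undecorate p) (length r) (length r + Suc (length m))"
        unfolding matching_pair_iff
        by (intro exI[of _ "map undecorate r"] exI[of _ "map undecorate m"]
            exI[of _ "map undecorate q"]) simp
      with \<open>?pairs\<close> have "\<exists>\<omega>\<in>\<Omega>. p ! length r = DUp \<omega> \<and> p ! (length r + Suc (length m)) = DDown \<omega>"
        by blast
      then show "\<exists>\<omega>\<in>\<Omega>. s = DUp \<omega> \<and> t = DDown \<omega>" by (simp add: p nth_append)
    qed
  next
    assume "matched \<Omega> p"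
    show ?pairs
    proof (intro allI impI)
      fix i j assume "matching_pair (map undecorate p) i j"
      then obtain r s m t q where p: "p = r @ s # m @ t # q"
        and st: "undecorate s = Up" "undecorate t = Down" "path_from 0 (map undecorate m)"
        and ij: "i = length r" "j = length r + Suc (length m)"
        unfolding matching_pair_iff by (auto simp: map_undecorate_factor)
      from matchedD[OF \<open>matched \<Omega> p\<close>[unfolded p] st]
      show "\<exists>\<omega>\<in>\<Omega>. p ! i = DUp \<omega> \<and> p ! j = DDown \<omega>"
        by (simp add: p ij nth_append)
    qed
  qed
  moreover have "(\<forall>i<length p. undecorate (p ! i) = Level \<longrightarrow> (\<exists>x\<in>X. p ! i = DLevel x)) \<longleftrightarrow>
      {x. DLevel x \<in> set p} \<subseteq> X"
  proof -
    have "(undecorate s = Level \<longrightarrow> (\<exists>x\<in>X. s = DLevel x)) \<longleftrightarrow> (\<forall>x. s = DLevel x \<longrightarrow> x \<in> X)"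
      for s :: "('x, 'w) dstep"
      by (cases s) auto
    then have "(\<forall>i<length p. undecorate (p ! i) = Level \<longrightarrow> (\<exists>x\<in>X. p ! i = DLevel x)) \<longleftrightarrow>
        (\<forall>s\<in>set p. \<forall>x. s = DLevel x \<longrightarrow> x \<in> X)"
      unfolding all_set_conv_all_nth by presburger
    then show ?thesis by blast
  qed
  ultimately show ?thesis
    by (simp add: decorated_motzkin_path_def motzkin_path_iff nested_def)
qed

lemma peak_free_iff:
  "peak_free p \<longleftrightarrow> p \<noteq> [] \<and> (\<nexists>r q. p = r @ Up # Down # q)"
proof -
  have "(\<exists>i. Suc i < length p \<and> p ! i = Up \<and> p ! Suc i = Down) \<longleftrightarrow> (\<exists>r q. p = r @ Up # Down # q)"
  proof
    assume "\<exists>i. Suc i < length p \<and> p ! i = Up \<and> p ! Suc i = Down"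
    then obtain i where "Suc i < length p" "p ! i = Up" "p ! Suc i = Down" by blast
    then have "p = take i p @ Up # Down # drop (Suc (Suc i)) p"
      by (metis Cons_nth_drop_Suc Suc_lessD append_take_drop_id)
    then show "\<exists>r q. p = r @ Up # Down # q" by blast
  next
    assume "\<exists>r q. p = r @ Up # Down # q"
    then obtain r q where "p = r @ Up # Down # q" by blast
    then show "\<exists>i. Suc i < length p \<and> p ! i = Up \<and> p ! Suc i = Down"
      by (intro exI[of _ "length r"]) (simp add: nth_append)
  qed
  then show ?thesis by (simp add: peak_free_def)
qed

lemma peak_free_undecorate_iff: "peak_free (map undecorate p) \<longleftrightarrow> p \<noteq> [] \<and> peakless p"
proof -
  have "(\<exists>r q. map undecorate p = r @ Up # Down # q) \<longleftrightarrow>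
     (\<exists>r s t q. p = r @ s # t # q \<and> undecorate s = Up \<and> undecorate t = Down)"
    using map_undecorate_factor[of p _ "[]"] by auto
  then show ?thesis by (simp add: peak_free_iff peakless_def)
qed

lemma motzkin_paths_eq:
  "motzkin_paths X \<Omega> =
     \<lparr>carrier = path.spell ` bracketed_words True X \<Omega>, mult = (@), one = [],
      oper = (\<lambda>\<omega> m. [DUp \<omega>] @ m @ [DDown \<omega>])\<rparr>"
  by (simp add: motzkin_paths_def decorated_motzkin_path_iff spell_image_bracketed_words)

lemma peak_free_motzkin_paths_eq:
  "peak_free_motzkin_paths X \<Omega> =
     \<lparr>carrier = path.spell ` (bracketed_words False X \<Omega> - {[]}), mult = (@), one = [],
      oper = (\<lambda>\<omega> m. [DUp \<omega>] @ m @ [DDown \<omega>])\<rparr>"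
proof -
  have "path.spell ` (bracketed_words False X \<Omega> - {[]}) =
      path.spell ` bracketed_words False X \<Omega> - {[]}"
    using image_set_diff[OF path.inj_spell, of "bracketed_words False X \<Omega>" "{[]}"] by simp
  also have "\<dots> = {p. decorated_motzkin_path X \<Omega> p \<and> peak_free (map undecorate p)}"
    by (auto simp: decorated_motzkin_path_iff spell_image_bracketed_words
        peak_free_undecorate_iff nested_def)
  finally show ?thesis by (simp add: peak_free_motzkin_paths_def motzkin_paths_def)
qed

theorem theorem3p4:
  fixes X :: "'x set" and \<Omega> :: "'w set"
  shows "(\<exists>f. operated_monoid_iso \<Omega> (bracketed_monoid X \<Omega>) (motzkin_words X \<Omega>) f \<and>
              (\<forall>x\<in>X. f [Gen x] = [Letter x])) \<and>
         (\<exists>f. operated_monoid_iso \<Omega> (bracketed_monoid X \<Omega>) (motzkin_paths X \<Omega>) f \<and>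
              (\<forall>x\<in>X. f [Gen x] = [DLevel x])) \<and>
         (\<exists>f. operated_semigroup_iso \<Omega> (bracketed_semigroup X \<Omega>) (peak_free_motzkin_paths X \<Omega>) f \<and>
              (\<forall>x\<in>X. f [Gen x] = [DLevel x]))"
  unfolding motzkin_words_eq motzkin_paths_eq peak_free_motzkin_paths_eq
proof (intro conjI)
  show "\<exists>f. operated_monoid_iso \<Omega> (bracketed_monoid X \<Omega>)
      \<lparr>carrier = word.spell ` bracketed_words True X \<Omega>, mult = (@), one = [],
       oper = (\<lambda>\<omega> m. [Slash \<omega>] @ m @ [Backslash \<omega>])\<rparr> f \<and> (\<forall>x\<in>X. f [Gen x] = [Letter x])"
    by (intro exI[of _ word.spell] conjI word.operated_monoid_iso_spell) simp
  show "\<exists>f. operated_monoid_iso \<Omega> (bracketed_monoid X \<Omega>)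
      \<lparr>carrier = path.spell ` bracketed_words True X \<Omega>, mult = (@), one = [],
       oper = (\<lambda>\<omega> m. [DUp \<omega>] @ m @ [DDown \<omega>])\<rparr> f \<and> (\<forall>x\<in>X. f [Gen x] = [DLevel x])"
    by (intro exI[of _ path.spell] conjI path.operated_monoid_iso_spell) simp
  show "\<exists>f. operated_semigroup_iso \<Omega> (bracketed_semigroup X \<Omega>)
      \<lparr>carrier = path.spell ` (bracketed_words False X \<Omega> - {[]}), mult = (@), one = [],
       oper = (\<lambda>\<omega> m. [DUp \<omega>] @ m @ [DDown \<omega>])\<rparr> f \<and> (\<forall>x\<in>X. f [Gen x] = [DLevel x])"
    by (intro exI[of _ path.spell] conjI path.operated_semigroup_iso_spell) simp
qed

end
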